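(* (a) Let $D=(V,A)$ be a finite acyclic digraph whose arcs admit a U-coloring. Then $D$ is the cover graph of the poset obtained as its transitive closure (i.e. $D$ is transitively reduced); hence the transitive closure of $D$ is a U-poset. (b) A poset $P$ is a finite upper locally distributive lattice if and only if $P$ is a U-poset with a global minimum.
   Context: For a digraph $D=(V,A)$, an arc coloring $c$ is a U-coloring if for all $u,v,w\in V$ with $u\neq w$ and $(v,u),(v,w)\in A$: (U$_1$) $c(v,u)\neq c(v,w)$; (U$_2$) there is $z\in V$ with arcs $(u,z),(w,z)\in A$ such that $c(v,u)=c(w,z)$ and $c(v,w)=c(u,z)$. A finite poset is a U-poset if the arcs of its cover graph (arc $(x,y)$ whenever $y$ covers $x$) admit a U-coloring. A poset $P$ is an upper locally distributive lattice (ULD) if $P$ is a lattice and every element has a unique minimal representation as a meet of meet-irreducible elements, i.e. there is a map $x\mapsto M_x$ assigning to each $x\in P$ a set $M_x$ of meet-irreducible elements with $x=\bigwedge M_x$, and such that whenever $x=\bigwedge B$ for a set $B$ of meet-irreducibles then $M_x\subseteq B$. *)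

theory Defs
  imports "HOL-Algebra.Lattice"
begin

definition U_coloring :: "'v set \<Rightarrow> ('v \<times> 'v) set \<Rightarrow> ('v \<times> 'v \<Rightarrow> 'c) \<Rightarrow> bool" where
  "U_coloring V A c \<longleftrightarrow>
    (\<forall>u\<in>V. \<forall>v\<in>V. \<forall>w\<in>V. u \<noteq> w \<and> (v, u) \<in> A \<and> (v, w) \<in> A \<longrightarrow>
      c (v, u) \<noteq> c (v, w) \<and>
      (\<exists>z\<in>V. (u, z) \<in> A \<and> (w, z) \<in> A \<and> c (v, u) = c (w, z) \<and> c (v, w) = c (u, z)))"

definition cover_arcs :: "('a, 'b) gorder_scheme \<Rightarrow> ('a \<times> 'a) set" where
  "cover_arcs P = {(x, y). x \<in> carrier P \<and> y \<in> carrier P \<and> x \<sqsubset>\<^bsub>P\<^esub> y \<and>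
     \<not> (\<exists>z\<in>carrier P. x \<sqsubset>\<^bsub>P\<^esub> z \<and> z \<sqsubset>\<^bsub>P\<^esub> y)}"

(* The poset is finite, so taking natural numbers as colors is no restriction. *)
definition U_poset :: "('a, 'b) gorder_scheme \<Rightarrow> bool" where
  "U_poset P \<longleftrightarrow> partial_order P \<and> finite (carrier P) \<and>
     (\<exists>c :: 'a \<times> 'a \<Rightarrow> nat. U_coloring (carrier P) (cover_arcs P) c)"

(* The order is reflexive, hence the reflexive transitive closure. *)
definition closure_poset :: "'v set \<Rightarrow> ('v \<times> 'v) set \<Rightarrow> 'v gorder" where
  "closure_poset V A = \<lparr>carrier = V, eq = (=), le = (\<lambda>x y. (x, y) \<in> A\<^sup>*)\<rparr>"

(* As usual, the greatest element (the empty meet) is not meet-irreducible. *)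
definition meet_irreducible :: "('a, 'b) gorder_scheme \<Rightarrow> 'a \<Rightarrow> bool" where
  "meet_irreducible P x \<longleftrightarrow> x \<in> carrier P \<and> \<not> greatest P x (carrier P) \<and>
     (\<forall>a\<in>carrier P. \<forall>b\<in>carrier P. x = a \<sqinter>\<^bsub>P\<^esub> b \<longrightarrow> x = a \<or> x = b)"

(* Lattices are nonempty by convention, whereas the locale lattice admits an empty carrier.
   The meet of a set is expressed by is_glb because the operator \<Sqinter> is unspecified
   where no greatest lower bound exists. *)
definition ULD :: "('a, 'b) gorder_scheme \<Rightarrow> bool" where
  "ULD P \<longleftrightarrow> lattice P \<and> carrier P \<noteq> {} \<and>
     (\<exists>M :: 'a \<Rightarrow> 'a set. \<forall>x\<in>carrier P.
        M x \<subseteq> {m. meet_irreducible P m} \<and> is_glb P x (M x) \<and>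
        (\<forall>B. B \<subseteq> {m. meet_irreducible P m} \<and> is_glb P x B \<longrightarrow> M x \<subseteq> B))"

end

theory Submission
  imports Defs "HOL-Library.Multiset"
begin

text \<open>
  In a U-colored acyclic digraph an arc \<open>v \<rightarrow> u\<close> can be pushed along any path from \<open>v\<close> to \<open>x\<close>: by the
  U-rule it is transported parallel to itself until the path uses its color, and then it is absorbed.
  This implies that all paths between two given vertices carry the same multiset of colors, so that no
  arc is parallel to a longer path. It also produces joins of any two vertices with a common lower
  bound, and every color on the way to the join already occurs below one of the two joinands.

  A finite lattice is ULD iff for each cover \<open>x \<prec> y\<close> exactly one meet-irreducible lies above \<open>x\<close> but
  not above \<open>y\<close>. In a U-poset two such elements would have a join that still avoids the color of
  \<open>(x, y)\<close>, although the only arc leaving either of them has that color. Conversely, in a ULD lattice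
  this meet-irreducible serves as the color of \<open>(x, y)\<close>.
\<close>

section \<open>U-colored acyclic digraphs\<close>

text \<open>Intermediate vertices are forgotten on purpose: what turns out to be independent of the
  chosen walk is the multiset of its colors. Multiplicities also record the length, which is needed
  to compare an arc with a detour.\<close>

inductive color_path :: "('v \<times> 'v) set \<Rightarrow> ('v \<times> 'v \<Rightarrow> 'c) \<Rightarrow> 'v \<Rightarrow> 'c multiset \<Rightarrow> 'v \<Rightarrow> bool"
  for A c where
  refl: "color_path A c v {#} v"
| step: "(v, u) \<in> A \<Longrightarrow> color_path A c u m x \<Longrightarrow> color_path A c v (add_mset (c (v, u)) m) x"

lemma color_path_trans:
  "color_path A c x m y \<Longrightarrow> color_path A c y n z \<Longrightarrow> color_path A c x (m + n) z"
  by (induction rule: color_path.induct) (auto intro: color_path.step)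

lemma color_path_arc: "(v, u) \<in> A \<Longrightarrow> color_path A c v {#c (v, u)#} u"
  by (rule color_path.step[OF _ color_path.refl])

lemma color_path_imp_rtrancl: "color_path A c v m x \<Longrightarrow> (v, x) \<in> A\<^sup>*"
  by (induction rule: color_path.induct) (auto intro: converse_rtrancl_into_rtrancl)

lemma rtrancl_imp_color_path: "(v, x) \<in> A\<^sup>* \<Longrightarrow> \<exists>m. color_path A c v m x"
proof (induction rule: converse_rtrancl_induct)
  case base
  show ?case by (rule exI, rule color_path.refl)
next
  case (step v u)
  then show ?case using color_path.step[of v u A c] by metis
qed

lemma trancl_imp_color_path: "(v, x) \<in> A\<^sup>+ \<Longrightarrow> \<exists>m. m \<noteq> {#} \<and> color_path A c v m x"
proof -
  assume "(v, x) \<in> A\<^sup>+"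
  then obtain u where "(v, u) \<in> A" "(u, x) \<in> A\<^sup>*" by (blast dest: tranclD)
  then show ?thesis using rtrancl_imp_color_path color_path.step[of v u A c] by (metis empty_not_add_mset)
qed

text \<open>Both U-conditions only compare colors for equality, so an injection of the finitely many
  colors into the naturals preserves them.\<close>

lemma U_coloring_nat:
  fixes c :: "'v \<times> 'v \<Rightarrow> 'c"
  assumes "finite A" "U_coloring V A c"
  shows "\<exists>d :: 'v \<times> 'v \<Rightarrow> nat. U_coloring V A d"
proof -
  obtain f :: "'c \<Rightarrow> nat" where "inj_on f (c ` A)"
    using finite_imp_inj_to_nat_seg[of "c ` A"] assms(1) by auto
  then have f: "f (c a) = f (c b) \<longleftrightarrow> c a = c b" if "a \<in> A" "b \<in> A" for a b
    using that by (auto dest: inj_onD)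
  have "U_coloring V A (f \<circ> c)"
    unfolding U_coloring_def comp_def
  proof (intro ballI impI, elim conjE)
    fix u v w assume uvw: "u \<in> V" "v \<in> V" "w \<in> V" "u \<noteq> w" "(v, u) \<in> A" "(v, w) \<in> A"
    then obtain z where "z \<in> V" "(u, z) \<in> A" "(w, z) \<in> A" "c (v, u) = c (w, z)"
      "c (v, w) = c (u, z)" and "c (v, u) \<noteq> c (v, w)"
      using assms(2) unfolding U_coloring_def by meson
    then show "f (c (v, u)) \<noteq> f (c (v, w)) \<and> (\<exists>z\<in>V. (u, z) \<in> A \<and> (w, z) \<in> A \<and>
        f (c (v, u)) = f (c (w, z)) \<and> f (c (v, w)) = f (c (u, z)))"
      using f uvw by auto
  qed
  then show ?thesis by blast
qed

locale U_digraph =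
  fixes V :: "'v set" and A :: "('v \<times> 'v) set" and c :: "'v \<times> 'v \<Rightarrow> 'c"
  assumes finite_verts: "finite V" and arcs_sub: "A \<subseteq> V \<times> V" and acyclic: "acyclic A"
    and coloring: "U_coloring V A c"
begin

lemma finite_arcs: "finite A"
  using finite_verts arcs_sub by (meson finite_SigmaI finite_subset)

lemma wf_converse_arcs: "wf (A\<inverse>)"
  by (rule finite_acyclic_wf_converse[OF finite_arcs acyclic])

lemma square:
  assumes "(v, u) \<in> A" "(v, w) \<in> A" "u \<noteq> w"
  obtains z where "c (v, u) \<noteq> c (v, w)" "(u, z) \<in> A" "(w, z) \<in> A"
    "c (w, z) = c (v, u)" "c (u, z) = c (v, w)"
proof -
  have "u \<in> V" "v \<in> V" "w \<in> V" using assms arcs_sub by auto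
  then show ?thesis
    using coloring assms that unfolding U_coloring_def by metis
qed

text \<open>The two alternatives are absorption and transport. If the path starts with the arc
  itself, the arc is absorbed. Otherwise the U-rule closes a square, and the opposite side is pushed
  along the rest of the path. By (U1) the skipped first color differs from the pushed one, so it
  does not affect which alternative occurs.\<close>

lemma push_arc:
  assumes "color_path A c v m x" "(v, u) \<in> A"
  shows "c (v, u) \<in># m \<and> color_path A c u (m - {#c (v, u)#}) x \<or>
    c (v, u) \<notin># m \<and> (\<exists>x'. (x, x') \<in> A \<and> c (x, x') = c (v, u) \<and> color_path A c u m x')"
  using assms
proof (induction arbitrary: u rule: color_path.induct)
  case (refl v)
  then show ?case by (auto intro: color_path.refl)
next
  case (step v w m x)
  show ?case
  proof (cases "u = w")
    case True
    then show ?thesis using step.hyps by simp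
  next
    case False
    then obtain z where z: "c (v, u) \<noteq> c (v, w)" "(u, z) \<in> A" "(w, z) \<in> A"
      "c (w, z) = c (v, u)" "c (u, z) = c (v, w)"
      using square[OF step.prems step.hyps(1)] by metis
    have lift: "color_path A c u (add_mset (c (v, w)) n) y" if "color_path A c z n y" for n y
      using color_path.step[OF z(2) that] z(5) by simp
    from step.IH[OF z(3)] show ?thesis
      unfolding z(4)
    proof (elim disjE conjE exE)
      assume "c (v, u) \<in># m" "color_path A c z (m - {#c (v, u)#}) x"
      then show ?thesis using lift z(1) by auto
    next
      fix x'
      assume "c (v, u) \<notin># m" "(x, x') \<in> A" "c (x, x') = c (v, u)" "color_path A c z m x'"
      then show ?thesis using lift z(1) by auto
    qed
  qed
qed

lemma color_path_closed:
  assumes "color_path A c v m v" shows "m = {#}"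
  using assms
proof cases
  case (step u n)
  then have "(v, v) \<in> A\<^sup>+" by (meson color_path_imp_rtrancl rtrancl_into_trancl2)
  then show ?thesis using acyclic by (simp add: acyclic_def)
qed simp

text \<open>The first arc of the second path is pushed along the first one. If it is absorbed, both
  remainders start at \<open>u\<close> and the induction hypothesis compares them. Transport would
  force its color into \<open>m\<close>, where it does not occur.\<close>

lemma color_path_unique:
  assumes "color_path A c v m x" "color_path A c v n x"
  shows "m = n"
  using assms
\<comment> \<open>The endpoint has to vary, because transport moves it from \<open>x\<close> to
  \<open>x'\<close>.\<close>
proof (induction v arbitrary: m n x rule: wf_induct_rule[OF wf_converse_arcs])
  case (1 v)
  show ?case
  proof (cases "x = v")
    case True
    then show ?thesis using 1 color_path_closed by metis
  next
    case False
    with 1(3) obtain u n' where u: "(v, u) \<in> A" "color_path A c u n' x"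
      and n: "n = add_mset (c (v, u)) n'"
      by (auto elim: color_path.cases)
    have IH: "m1 = m2" if "color_path A c u m1 y" "color_path A c u m2 y" for m1 m2 y
      using 1(1)[of u] u that by simp
    from push_arc[OF 1(2) u(1)] show ?thesis
    proof (elim disjE conjE exE)
      assume "c (v, u) \<in># m" "color_path A c u (m - {#c (v, u)#}) x"
      then show ?thesis using IH[OF u(2)] n by simp
    next
      fix x' assume *: "c (v, u) \<notin># m" "(x, x') \<in> A" "c (x, x') = c (v, u)" "color_path A c u m x'"
      \<comment> \<open>Prolonging the second path to \<open>x'\<close> makes the two comparable from \<open>u\<close> on.\<close>
      have "color_path A c u (n' + {#c (x, x')#}) x'"
        by (rule color_path_trans[OF u(2) color_path_arc[OF *(2)]])
      then have "m = n' + {#c (x, x')#}" using IH *(4) by blast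
      then show ?thesis using * by simp
    qed
  qed
qed

text \<open>Some path to \<open>x\<close> begins with the arc \<open>(v, u)\<close>, and by
  uniqueness every path from \<open>v\<close> to \<open>x\<close> has the same colors.\<close>

lemma color_in_path:
  assumes "(v, u) \<in> A" "(u, x) \<in> A\<^sup>*" "color_path A c v m x"
  shows "c (v, u) \<in># m"
proof -
  obtain n where "color_path A c u n x" using rtrancl_imp_color_path[OF assms(2)] by blast
  then have "m = add_mset (c (v, u)) n"
    using color_path_unique[OF assms(3) color_path.step[OF assms(1)]] by blast
  then show ?thesis by simp
qed

text \<open>The arc carries one color, the detour through \<open>z\<close> at least two,
  contradicting uniqueness. This is transitive reducedness.\<close>

lemma arc_not_parallel_to_path:
  assumes "(x, y) \<in> A" "(x, z) \<in> A\<^sup>+" "(z, y) \<in> A\<^sup>+"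
  shows False
proof -
  obtain m n where m: "m \<noteq> {#}" "color_path A c x m z" and n: "n \<noteq> {#}" "color_path A c z n y"
    using trancl_imp_color_path assms(2,3) by meson
  have "{#c (x, y)#} = m + n"
    using color_path_unique color_path_arc[OF assms(1)] color_path_trans[OF m(2) n(2)] by metis
  then show False using m(1) n(1) by (auto simp: single_is_union)
qed

text \<open>The arcs of the path to \<open>y\<close> are pushed one after another along the path to
  \<open>x\<close>; the transported ones form the path from \<open>x\<close> to the join. The bound
  on \<open>k\<close> records that only colors of the path to \<open>y\<close> arise this
  way.\<close>

lemma join_exists:
  assumes "color_path A c v n y" "color_path A c v m x"
  shows "\<exists>z k. color_path A c x k z \<and> (y, z) \<in> A\<^sup>* \<and> set_mset k \<subseteq> set_mset n \<and>
    (\<forall>t. (x, t) \<in> A\<^sup>* \<longrightarrow> (y, t) \<in> A\<^sup>* \<longrightarrow> (z, t) \<in> A\<^sup>*)"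
  using assms
proof (induction arbitrary: m x rule: color_path.induct)
  case (refl v)
  then show ?case by (auto dest: color_path_imp_rtrancl intro: color_path.refl)
next
  case (step v u n y)
  let ?i = "c (v, u)"
  \<comment> \<open>First \<open>x\<close> is joined with \<open>u\<close> alone. The induction
    hypothesis then joins the result with \<open>y\<close>, which suffices because \<open>u\<close>
    lies below \<open>y\<close>.\<close>
  have "\<exists>z k l. color_path A c x k z \<and> color_path A c u l z \<and> set_mset k \<subseteq> {?i} \<and>
    (\<forall>t. (x, t) \<in> A\<^sup>* \<longrightarrow> (u, t) \<in> A\<^sup>* \<longrightarrow> (z, t) \<in> A\<^sup>*)"
    using push_arc[OF step.prems step.hyps(1)]
  proof (elim disjE conjE exE)
    assume "color_path A c u (m - {#?i#}) x"
    then show ?thesis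
      by (intro exI[of _ x] exI[of _ "{#}"] exI[of _ "m - {#?i#}"]) (auto intro: color_path.refl)
  next
    fix x' assume *: "?i \<notin># m" "(x, x') \<in> A" "c (x, x') = ?i" "color_path A c u m x'"
    \<comment> \<open>A path from \<open>v\<close> to \<open>t\<close> via \<open>x\<close> contains
      the color \<open>?i\<close>, which \<open>m\<close> lacks. Hence the part after
      \<open>x\<close> contains it and absorbs the arc \<open>(x, x')\<close>.\<close>
    have "(x', t) \<in> A\<^sup>*" if xt: "(x, t) \<in> A\<^sup>*" and ut: "(u, t) \<in> A\<^sup>*" for t
    proof -
      obtain k where k: "color_path A c x k t" using rtrancl_imp_color_path[OF xt] by blast
      have "?i \<in># m + k"
        by (rule color_in_path[OF step.hyps(1) ut color_path_trans[OF step.prems k]])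
      then have "?i \<in># k" using *(1) by simp
      then show ?thesis using push_arc[OF k *(2)] *(3) color_path_imp_rtrancl by metis
    qed
    moreover have "color_path A c x {#?i#} x'" using color_path_arc[OF *(2), of c] *(3) by simp
    ultimately show ?thesis using *(4)
      by (intro exI[of _ x'] exI[of _ "{#?i#}"] exI[of _ m]) auto
  qed
  then obtain z1 k1 l where z1: "color_path A c x k1 z1" "color_path A c u l z1"
    "set_mset k1 \<subseteq> {?i}" "\<And>t. (x, t) \<in> A\<^sup>* \<Longrightarrow> (u, t) \<in> A\<^sup>* \<Longrightarrow> (z1, t) \<in> A\<^sup>*" by metis
  from step.IH[OF z1(2)] obtain z k where z: "color_path A c z1 k z" "(y, z) \<in> A\<^sup>*"
    "set_mset k \<subseteq> set_mset n" "\<And>t. (z1, t) \<in> A\<^sup>* \<Longrightarrow> (y, t) \<in> A\<^sup>* \<Longrightarrow> (z, t) \<in> A\<^sup>*" by metis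
  have uy: "(u, y) \<in> A\<^sup>*" using color_path_imp_rtrancl[OF step.hyps(2)] .
  have "color_path A c x (k1 + k) z" by (rule color_path_trans[OF z1(1) z(1)])
  moreover have "set_mset (k1 + k) \<subseteq> set_mset (add_mset ?i n)" using z1(3) z(3) by auto
  moreover have "(z, t) \<in> A\<^sup>*" if "(x, t) \<in> A\<^sup>*" "(y, t) \<in> A\<^sup>*" for t
    using z(4) z1(4) that uy by (meson rtrancl_trans)
  ultimately show ?case using z(2) by blast
qed

section \<open>The poset generated by a U-colored acyclic digraph\<close>

lemma partial_order_closure: "partial_order (closure_poset V A)"
  unfolding closure_poset_def
  by unfold_locales (auto intro: rtrancl_trans acyclic_impl_antisym_rtrancl[OF acyclic, THEN antisymD])

lemma cover_arcs_closure: "cover_arcs (closure_poset V A) = A"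
proof -
  let ?P = "closure_poset V A"
  interpret partial_order ?P by (rule partial_order_closure)
  have lt: "x \<sqsubset>\<^bsub>?P\<^esub> y \<longleftrightarrow> (x, y) \<in> A\<^sup>+" for x y
    using acyclic unfolding lless_eq
    by (auto simp: closure_poset_def rtrancl_eq_or_trancl acyclic_def)
  have carrier: "carrier ?P = V" by (simp add: closure_poset_def)
  show ?thesis
  proof (intro equalityI subrelI)
    fix x y assume xy: "(x, y) \<in> cover_arcs ?P"
    then have "(x, y) \<in> A\<^sup>+" by (simp add: cover_arcs_def lt)
    then obtain z where z: "(x, z) \<in> A" "(z, y) \<in> A\<^sup>*" by (blast dest: tranclD)
    show "(x, y) \<in> A"
    proof (cases "z = y")
      case False
      then have "(z, y) \<in> A\<^sup>+" using z(2) by (simp add: rtrancl_eq_or_trancl)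
      moreover have "z \<in> V" using z(1) arcs_sub by auto
      ultimately show ?thesis using xy z(1) by (auto simp: cover_arcs_def lt carrier)
    qed (use z in simp)
  next
    fix x y assume xy: "(x, y) \<in> A"
    then show "(x, y) \<in> cover_arcs ?P"
      using arcs_sub arc_not_parallel_to_path[OF xy]
      by (auto simp: cover_arcs_def lt carrier)
  qed
qed

lemma U_poset_closure: "U_poset (closure_poset V A)"
proof -
  have "carrier (closure_poset V A) = V" by (simp add: closure_poset_def)
  then show ?thesis
    using U_coloring_nat[OF finite_arcs coloring] partial_order_closure finite_verts
    by (simp add: U_poset_def cover_arcs_closure)
qed

end

section \<open>Covers and meet-irreducibles\<close>

locale finite_poset = partial_order L for L :: "('a, 'b) gorder_scheme" (structure) +
  assumes finite_carrier: "finite (carrier L)"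
begin

lemma asymp_transp_lless:
  assumes "S \<subseteq> carrier L"
  shows "asymp_on S (\<sqsubset>)" "transp_on S (\<sqsubset>)"
proof -
  show "asymp_on S (\<sqsubset>)"
    by (intro asymp_onI notI) (meson assms lless_antisym subsetD)
  show "transp_on S (\<sqsubset>)"
    by (intro transp_onI) (meson assms lless_trans subsetD)
qed

lemma maximal_exists:
  assumes "S \<subseteq> carrier L" "S \<noteq> {}"
  obtains m where "m \<in> S" "\<And>x. x \<in> S \<Longrightarrow> m \<sqsubseteq> x \<Longrightarrow> x = m"
  using Finite_Set.bex_max_element[OF finite_subset[OF assms(1) finite_carrier]
      asymp_transp_lless[OF assms(1)] assms(2)]
  by (auto simp: lless_eq)

lemma cover_below_exists:
  assumes "x \<in> carrier L" "y \<in> carrier L" "x \<sqsubset> y"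
  obtains z where "(x, z) \<in> cover_arcs L" "z \<sqsubseteq> y"
proof -
  let ?S = "{z \<in> carrier L. x \<sqsubset> z \<and> z \<sqsubseteq> y}"
  have "finite ?S" "?S \<noteq> {}" using assms finite_carrier by auto
  then obtain z where z: "z \<in> ?S" and min: "\<forall>w\<in>?S. w \<noteq> z \<longrightarrow> \<not> w \<sqsubset> z"
    using Finite_Set.bex_min_element[OF _ asymp_transp_lless[of ?S]] by auto
  have "\<not> (x \<sqsubset> w \<and> w \<sqsubset> z)" if "w \<in> carrier L" for w
    using min z that assms le_trans[of w z y] by (auto simp: lless_eq)
  then have "(x, z) \<in> cover_arcs L" using z assms by (auto simp: cover_arcs_def)
  then show ?thesis using that z by blast
qed

lemma cover_arcs_closed: "cover_arcs L \<subseteq> carrier L \<times> carrier L"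
  by (auto simp: cover_arcs_def)

lemma trancl_cover_arcs_lless:
  assumes "(x, y) \<in> (cover_arcs L)\<^sup>+" shows "x \<in> carrier L \<and> y \<in> carrier L \<and> x \<sqsubset> y"
  using assms
proof (induction rule: trancl_induct)
  case (step y z)
  then show ?case using lless_trans[of x y z] by (auto simp: cover_arcs_def)
qed (auto simp: cover_arcs_def)

lemma acyclic_cover_arcs: "acyclic (cover_arcs L)"
  using trancl_cover_arcs_lless by (force simp: acyclic_def lless_eq)

text \<open>This bridge carries the results on reachability in digraphs over to the order of a
  finite poset.\<close>

lemma le_iff_rtrancl_cover_arcs:
  assumes "x \<in> carrier L" "y \<in> carrier L"
  shows "x \<sqsubseteq> y \<longleftrightarrow> (x, y) \<in> (cover_arcs L)\<^sup>*"
proof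
  have "finite (cover_arcs L)"
    using cover_arcs_closed finite_carrier by (meson finite_SigmaI finite_subset)
  then have wf: "wf ((cover_arcs L)\<inverse>)"
    by (rule finite_acyclic_wf_converse[OF _ acyclic_cover_arcs])
  show "x \<sqsubseteq> y \<Longrightarrow> (x, y) \<in> (cover_arcs L)\<^sup>*"
    using assms(1)
  proof (induction x rule: wf_induct_rule[OF wf])
    case (1 x)
    show ?case
    proof (cases "x = y")
      case False
      then obtain z where z: "(x, z) \<in> cover_arcs L" "z \<sqsubseteq> y"
        using cover_below_exists[of x y] 1(2,3) assms(2) by (auto simp: lless_eq)
      then have "(z, y) \<in> (cover_arcs L)\<^sup>*" using 1(1)[of z] cover_arcs_closed by auto
      then show ?thesis using z(1) by (rule converse_rtrancl_into_rtrancl[rotated])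
    qed simp
  qed
next
  show "(x, y) \<in> (cover_arcs L)\<^sup>* \<Longrightarrow> x \<sqsubseteq> y"
    using trancl_cover_arcs_lless[of x y] assms by (auto simp: rtrancl_eq_or_trancl lless_eq)
qed

end

text \<open>For a cover \<open>(x, y)\<close>, uniqueness of such an \<open>m\<close> is the form in
  which the ULD property is used in both directions.\<close>

definition separating :: "('a, 'b) gorder_scheme \<Rightarrow> 'a \<Rightarrow> 'a \<Rightarrow> 'a \<Rightarrow> bool" where
  "separating L x y m \<longleftrightarrow> meet_irreducible L m \<and> x \<sqsubseteq>\<^bsub>L\<^esub> m \<and> \<not> y \<sqsubseteq>\<^bsub>L\<^esub> m"

lemma separating_closed: "separating L x y m \<Longrightarrow> m \<in> carrier L"
  by (simp add: separating_def meet_irreducible_def)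

section \<open>Meet representations in finite lattices\<close>

locale finite_lattice = lattice L + finite_poset L for L :: "('a, 'b) gorder_scheme" (structure)
begin

text \<open>Take \<open>m\<close> maximal among the elements above \<open>x\<close> but not above
  \<open>y\<close>. Everything strictly above \<open>m\<close> is above \<open>y\<close>, and so is
  the meet of two such elements; hence that meet is not \<open>m\<close>.\<close>

lemma separating_exists:
  assumes "x \<in> carrier L" "y \<in> carrier L" "\<not> y \<sqsubseteq> x"
  obtains m where "separating L x y m"
proof -
  let ?S = "{z \<in> carrier L. x \<sqsubseteq> z \<and> \<not> y \<sqsubseteq> z}"
  have S: "?S \<subseteq> carrier L" "?S \<noteq> {}" using assms by auto
  obtain m where m: "m \<in> ?S" and max: "\<And>z. z \<in> ?S \<Longrightarrow> m \<sqsubseteq> z \<Longrightarrow> z = m"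
    by (rule maximal_exists[OF S]) blast
  have above: "y \<sqsubseteq> a" if "a \<in> carrier L" "m \<sqsubseteq> a" "a \<noteq> m" for a
    using max[of a] m that le_trans[of x m a] assms by auto
  have "m = a \<or> m = b" if "a \<in> carrier L" "b \<in> carrier L" "m = a \<sqinter> b" for a b
    using above[of a] above[of b] that m meet_left[of a b] meet_right[of a b] meet_le[of y a b]
      assms(2) by auto
  moreover have "\<not> greatest L m (carrier L)"
    using m assms by (auto simp: greatest_def)
  ultimately have "separating L x y m"
    using m by (auto simp: separating_def meet_irreducible_def)
  then show ?thesis by (rule that)
qed

text \<open>Two distinct covers of an element have that element as their meet.\<close>

lemma meet_irreducible_unique_cover:
  assumes "meet_irreducible L m" "(m, a) \<in> cover_arcs L" "(m, b) \<in> cover_arcs L"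
  shows "a = b"
proof (rule ccontr)
  assume "a \<noteq> b"
  have car: "m \<in> carrier L" "a \<in> carrier L" "b \<in> carrier L"
    and lt: "m \<sqsubset> a" "m \<sqsubset> b" using assms(2,3) by (auto simp: cover_arcs_def)
  have le: "m \<sqsubseteq> a \<sqinter> b" using meet_le car lt by (simp add: lless_eq)
  have "m \<noteq> a \<sqinter> b"
    using assms(1) car lt by (auto simp: meet_irreducible_def lless_eq)
  then have "m \<sqsubset> a \<sqinter> b" using le by (simp add: lless_eq)
  then have "\<not> a \<sqinter> b \<sqsubset> a" "\<not> a \<sqinter> b \<sqsubset> b"
    using assms(2,3) car by (auto simp: cover_arcs_def)
  then have "a \<sqinter> b = a" "a \<sqinter> b = b"
    using meet_left[OF car(2,3)] meet_right[OF car(2,3)] unfolding lless_eq by blast+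
  then show False using \<open>a \<noteq> b\<close> by simp
qed

text \<open>If a lower bound \<open>l\<close> of \<open>B\<close> is not below \<open>x\<close>,
  then the join of \<open>x\<close> and \<open>l\<close> is a lower bound strictly above
  \<open>x\<close>, and so some cover of \<open>x\<close> is a lower bound too. Thus only the covers
  of \<open>x\<close> need testing.\<close>

lemma is_glb_iff_covers:
  assumes "x \<in> carrier L" "B \<subseteq> carrier L" "\<And>b. b \<in> B \<Longrightarrow> x \<sqsubseteq> b"
  shows "is_glb L x B \<longleftrightarrow> (\<forall>y. (x, y) \<in> cover_arcs L \<longrightarrow> (\<exists>b\<in>B. \<not> y \<sqsubseteq> b))"
proof
  assume glb: "is_glb L x B"
  show "\<forall>y. (x, y) \<in> cover_arcs L \<longrightarrow> (\<exists>b\<in>B. \<not> y \<sqsubseteq> b)"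
  proof (intro allI impI, rule ccontr)
    fix y assume xy: "(x, y) \<in> cover_arcs L" and "\<not> (\<exists>b\<in>B. \<not> y \<sqsubseteq> b)"
    then have "y \<in> Lower L B" by (auto simp: Lower_def cover_arcs_def)
    then have "y \<sqsubseteq> x" using glb by (simp add: greatest_def)
    then show False using xy le_antisym by (auto simp: cover_arcs_def lless_eq)
  qed
next
  assume *: "\<forall>y. (x, y) \<in> cover_arcs L \<longrightarrow> (\<exists>b\<in>B. \<not> y \<sqsubseteq> b)"
  show "is_glb L x B"
  proof (rule greatest_LowerI)
    fix l assume l: "l \<in> Lower L B"
    then have lc: "l \<in> carrier L" by (simp add: Lower_def)
    have le: "x \<sqsubseteq> x \<squnion> l" "l \<sqsubseteq> x \<squnion> l" "x \<squnion> l \<in> carrier L"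
      using assms(1) lc join_left join_right by auto
    show "l \<sqsubseteq> x"
    proof (rule ccontr)
      assume "\<not> l \<sqsubseteq> x"
      then have "x \<sqsubset> x \<squnion> l" using le by (auto simp: lless_eq)
      then obtain y where y: "(x, y) \<in> cover_arcs L" "y \<sqsubseteq> x \<squnion> l"
        using cover_below_exists[OF assms(1) le(3)] by blast
      then obtain b where b: "b \<in> B" "\<not> y \<sqsubseteq> b" using * by blast
      have bc: "b \<in> carrier L" using b(1) assms(2) by blast
      have "x \<squnion> l \<sqsubseteq> b" using join_le[of x b l] assms b(1) l lc bc by (auto simp: Lower_def)
      then show False using b(2) y le_trans[of y "x \<squnion> l" b] bc le(3) by (auto simp: cover_arcs_def)
    qed
  qed (use assms in auto)
qed

text \<open>Each separating element together with the irreducibles in \<open>B\<close> represents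
  \<open>x\<close>. If there were two, the minimal representation would lie in both sets, hence in
  \<open>B\<close>, all of whose elements are above \<open>y\<close>.\<close>

lemma ULD_imp_separating_unique:
  assumes "ULD L" "(x, y) \<in> cover_arcs L" "separating L x y m" "separating L x y n"
  shows "m = n"
proof (rule ccontr)
  assume "m \<noteq> n"
  have x: "x \<in> carrier L" using assms(2) by (auto simp: cover_arcs_def)
  then obtain M where M: "M \<subseteq> {m. meet_irreducible L m}" "is_glb L x M"
    and min: "\<And>B. B \<subseteq> {m. meet_irreducible L m} \<Longrightarrow> is_glb L x B \<Longrightarrow> M \<subseteq> B"
    using assms(1) unfolding ULD_def by metis
  define B where "B = {b. meet_irreducible L b \<and> x \<sqsubseteq> b \<and> y \<sqsubseteq> b}"
  have M_sub: "M \<subseteq> insert k B" if k: "separating L x y k" for k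
  proof (rule min)
    show "insert k B \<subseteq> {m. meet_irreducible L m}" using k by (auto simp: B_def separating_def)
    have "\<exists>b\<in>insert k B. \<not> z \<sqsubseteq> b" if z: "(x, z) \<in> cover_arcs L" for z
    proof (cases "z = y")
      case True
      then show ?thesis using k by (simp add: separating_def)
    next
      case False
      \<comment> \<open>Two distinct covers of \<open>x\<close> are incomparable, so an irreducible
        above \<open>y\<close> excludes \<open>z\<close>; it belongs to \<open>B\<close>.\<close>
      have "\<not> z \<sqsubseteq> y" using z assms(2) False by (auto simp: cover_arcs_def lless_eq)
      then obtain b where b: "separating L y z b"
        using separating_exists[of y z] z assms(2) by (auto simp: cover_arcs_def)
      then have "x \<sqsubseteq> b"
        using le_trans[of x y b] assms(2) separating_closed[OF b]
        by (auto simp: cover_arcs_def separating_def lless_eq)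
      then show ?thesis using b by (auto simp: B_def separating_def)
    qed
    moreover have "insert k B \<subseteq> carrier L" "\<And>b. b \<in> insert k B \<Longrightarrow> x \<sqsubseteq> b"
      using k by (auto simp: B_def separating_def meet_irreducible_def)
    ultimately show "is_glb L x (insert k B)" using is_glb_iff_covers[OF x] by blast
  qed
  then have "M \<subseteq> B" using assms(3,4) \<open>m \<noteq> n\<close> by blast
  moreover have "M \<subseteq> carrier L" using M(1) by (auto simp: meet_irreducible_def)
  ultimately have "\<forall>b\<in>M. y \<sqsubseteq> b" "\<forall>b\<in>M. x \<sqsubseteq> b" by (auto simp: B_def)
  then show False
    using is_glb_iff_covers[OF x \<open>M \<subseteq> carrier L\<close>] M(2) assms(2) by blast
qed

text \<open>The minimal representation collects the separating elements of all covers of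
  \<open>x\<close>. Any representation must exclude each cover, and by uniqueness only this element
  can do so.\<close>

lemma separating_unique_imp_ULD:
  assumes "carrier L \<noteq> {}"
    and unique: "\<And>x y m n. (x, y) \<in> cover_arcs L \<Longrightarrow> separating L x y m \<Longrightarrow> separating L x y n \<Longrightarrow> m = n"
  shows "ULD L"
proof -
  define M where "M x = {m. \<exists>y. (x, y) \<in> cover_arcs L \<and> separating L x y m}" for x
  have "M x \<subseteq> {m. meet_irreducible L m}" for x by (auto simp: M_def separating_def)
  moreover have "is_glb L x (M x)" if x: "x \<in> carrier L" for x
  proof -
    have "\<exists>b\<in>M x. \<not> y \<sqsubseteq> b" if xy: "(x, y) \<in> cover_arcs L" for y
    proof -
      have "y \<in> carrier L" "\<not> y \<sqsubseteq> x" using xy x le_antisym by (auto simp: cover_arcs_def lless_eq)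
      then obtain m where "separating L x y m" using separating_exists x by blast
      then show ?thesis using xy by (auto simp: M_def separating_def)
    qed
    moreover have "M x \<subseteq> carrier L" by (auto simp: M_def separating_closed)
    moreover have "x \<sqsubseteq> b" if "b \<in> M x" for b using that by (auto simp: M_def separating_def)
    ultimately show ?thesis using is_glb_iff_covers[OF x] by blast
  qed
  moreover have "M x \<subseteq> B"
    if x: "x \<in> carrier L" and B: "B \<subseteq> {m. meet_irreducible L m}" "is_glb L x B" for x B
  proof
    fix m assume "m \<in> M x"
    then obtain y where y: "(x, y) \<in> cover_arcs L" "separating L x y m" by (auto simp: M_def)
    have Bc: "B \<subseteq> carrier L" using B(1) by (auto simp: meet_irreducible_def)
    then have above: "x \<sqsubseteq> b" if "b \<in> B" for b
      using greatest_Lower_below[OF B(2) that] by blast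
    then obtain b where b: "b \<in> B" "\<not> y \<sqsubseteq> b"
      using is_glb_iff_covers[OF x Bc] B(2) y(1) by blast
    then have "separating L x y b" using above B(1) by (auto simp: separating_def)
    then show "m \<in> B" using unique y b(1) by blast
  qed
  ultimately show ?thesis
    unfolding ULD_def using assms(1) lattice_axioms by (intro conjI exI[of _ M]) auto
qed

lemma least_exists:
  assumes "carrier L \<noteq> {}"
  shows "\<exists>b. least L b (carrier L)"
  using finite_inf_greatest[OF finite_carrier _ assms] greatest_Lower_below[of L _ "carrier L"]
  by (auto simp: least_def intro!: exI[of _ "\<Sqinter>carrier L"] finite_inf_closed[OF finite_carrier _ assms])

text \<open>The color of a cover is its unique separating irreducible, and the square over two
  covers \<open>u\<close> and \<open>w\<close> of \<open>v\<close> is closed by their join.\<close>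

lemma ULD_imp_U_poset:
  assumes "ULD L"
  shows "U_poset L"
proof -
  note unique = ULD_imp_separating_unique[OF assms]
  define c where "c = (\<lambda>(x, y). THE m. separating L x y m)"
  have c: "c (x, y) = m" if "(x, y) \<in> cover_arcs L" "separating L x y m" for x y m
    using unique[OF that(1)] that(2) by (auto simp: c_def)
  have cover: "x \<in> carrier L" "y \<in> carrier L" "x \<sqsubseteq> y" "\<not> y \<sqsubseteq> x" if "(x, y) \<in> cover_arcs L" for x y
    using that le_antisym by (auto simp: cover_arcs_def lless_eq)
  \<comment> \<open>Separating elements found at a higher vertex remain separating at a lower one;
    this identifies the colors of parallel arcs.\<close>
  have down: "separating L v w m"
    if "separating L u w m" "v \<sqsubseteq> u" "v \<in> carrier L" "u \<in> carrier L" for u v w m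
    using that le_trans[of v u m] separating_closed[OF that(1)] by (auto simp: separating_def)
  have not_le: "\<not> w \<sqsubseteq> u"
    if "(v, u) \<in> cover_arcs L" "(v, w) \<in> cover_arcs L" "u \<noteq> w" for u v w
    using that by (auto simp: cover_arcs_def lless_eq)
  have color_above: "\<exists>m. separating L u w m \<and> c (v, w) = m"
    if uvw: "(v, u) \<in> cover_arcs L" "(v, w) \<in> cover_arcs L" "u \<noteq> w" for u v w
  proof -
    obtain m where "separating L u w m"
      using separating_exists cover uvw not_le by metis
    then show ?thesis using c[OF uvw(2)] down cover uvw by metis
  qed
  have square: "(u, u \<squnion> w) \<in> cover_arcs L \<and> c (u, u \<squnion> w) = c (v, w)"
    if uvw: "(v, u) \<in> cover_arcs L" "(v, w) \<in> cover_arcs L" "u \<noteq> w" for u v w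
  proof -
    let ?z = "u \<squnion> w"
    note car = cover[OF uvw(1)] cover[OF uvw(2)]
    have z: "?z \<in> carrier L" "u \<sqsubseteq> ?z" "w \<sqsubseteq> ?z"
      using car join_left join_right by auto
    have "u \<sqsubset> ?z" using z not_le[OF uvw] by (auto simp: lless_eq)
    \<comment> \<open>The aim is \<open>t = ?z\<close>: some cover of \<open>u\<close> below the
      join is already the join.\<close>
    then obtain t where t: "(u, t) \<in> cover_arcs L" "t \<sqsubseteq> ?z"
      using cover_below_exists car z by metis
    note tc = cover[OF t(1)]
    obtain m where m: "separating L u t m" using separating_exists tc by metis
    then have mc: "m \<in> carrier L" "u \<sqsubseteq> m" "\<not> t \<sqsubseteq> m"
      using separating_closed[OF m] by (auto simp: separating_def)
    have "\<not> w \<sqsubseteq> m"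
      using join_le[of u m w] mc car le_trans[OF t(2)] z tc by blast
    then have "separating L u w m" using m by (simp add: separating_def)
    then have cm: "c (v, w) = m" using c[OF uvw(2)] down car by blast
    \<comment> \<open>Otherwise an irreducible \<open>n\<close> above \<open>t\<close> but not above
      \<open>w\<close> would also be the color of \<open>(v, w)\<close>. Then \<open>n = m\<close>,
      although \<open>m\<close> is not above \<open>t\<close>.\<close>
    have "w \<sqsubseteq> t"
    proof (rule ccontr)
      assume "\<not> w \<sqsubseteq> t"
      then obtain n where n: "separating L t w n" using separating_exists tc car by metis
      then have "c (v, w) = n" using c[OF uvw(2)] down tc car by metis
      then show False using n cm mc by (simp add: separating_def)
    qed
    then have "t = ?z" using join_le[of u t w] tc car t(2) z le_antisym by blast
    then show ?thesis using t(1) c[OF t(1) m] cm by simp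
  qed
  have "U_coloring (carrier L) (cover_arcs L) c"
    unfolding U_coloring_def
  proof (intro ballI impI, elim conjE)
    fix u v w assume uvw: "u \<noteq> w" "(v, u) \<in> cover_arcs L" "(v, w) \<in> cover_arcs L"
    \<comment> \<open>The color of \<open>(v, w)\<close> lies above \<open>u\<close>, the color of
      \<open>(v, u)\<close> does not.\<close>
    have "c (v, u) \<noteq> c (v, w)"
      using color_above[OF uvw(2,3,1)] color_above[OF uvw(3,2)] uvw(1) by (auto simp: separating_def)
    moreover have "u \<squnion> w = w \<squnion> u" by (rule join_comm)
    moreover have "u \<squnion> w \<in> carrier L" using cover uvw by simp
    ultimately show "c (v, u) \<noteq> c (v, w) \<and> (\<exists>z\<in>carrier L. (u, z) \<in> cover_arcs L \<and>
        (w, z) \<in> cover_arcs L \<and> c (v, u) = c (w, z) \<and> c (v, w) = c (u, z))"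
      using square[OF uvw(2,3,1)] square[OF uvw(3,2)] uvw(1) by metis
  qed
  moreover have "finite (cover_arcs L)"
    using cover_arcs_closed finite_carrier by (meson finite_SigmaI finite_subset)
  ultimately show ?thesis
    using U_coloring_nat finite_carrier partial_order_axioms unfolding U_poset_def by blast
qed

end

section \<open>U-posets with a global minimum\<close>

locale U_order = finite_poset L for L :: "('a, 'b) gorder_scheme" (structure) +
  fixes c :: "'a \<times> 'a \<Rightarrow> 'c" and bot :: 'a
  assumes U_coloring_covers: "U_coloring (carrier L) (cover_arcs L) c"
    and least_bot: "least L bot (carrier L)"

sublocale U_order \<subseteq> U: U_digraph "carrier L" "cover_arcs L" c
  by unfold_locales (rule finite_carrier cover_arcs_closed acyclic_cover_arcs U_coloring_covers)+

context U_order
begin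

abbreviation path :: "'a \<Rightarrow> 'c multiset \<Rightarrow> 'a \<Rightarrow> bool" where
  "path \<equiv> color_path (cover_arcs L) c"

lemma path_exists:
  assumes "x \<in> carrier L" "y \<in> carrier L" "x \<sqsubseteq> y"
  obtains m where "path x m y"
  using rtrancl_imp_color_path le_iff_rtrancl_cover_arcs assms by metis

lemma path_closed:
  assumes "path x m y" "x \<in> carrier L"
  shows "y \<in> carrier L \<and> x \<sqsubseteq> y"
  using color_path_imp_rtrancl[OF assms(1)] trancl_cover_arcs_lless[of x y] assms(2)
  by (auto simp: rtrancl_eq_or_trancl lless_eq)

lemma lub_exists:
  assumes "path v m x" "path v n y" "v \<in> carrier L"
  obtains z k where "path x k z" "set_mset k \<subseteq> set_mset n" "least L z (Upper L {x, y})"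
proof -
  obtain z k where z: "path x k z" "(y, z) \<in> (cover_arcs L)\<^sup>*" "set_mset k \<subseteq> set_mset n"
    "\<And>t. (x, t) \<in> (cover_arcs L)\<^sup>* \<Longrightarrow> (y, t) \<in> (cover_arcs L)\<^sup>* \<Longrightarrow> (z, t) \<in> (cover_arcs L)\<^sup>*"
    using U.join_exists[OF assms(2,1)] by metis
  have car: "x \<in> carrier L" "y \<in> carrier L" using path_closed assms by auto
  moreover have "z \<in> carrier L" "x \<sqsubseteq> z" using path_closed[OF z(1)] car by auto
  ultimately have "least L z (Upper L {x, y})"
    using z(2,4) le_iff_rtrancl_cover_arcs by (auto simp: least_def Upper_def)
  then show ?thesis using that z by blast
qed

text \<open>Paths from \<open>bot\<close> give the joins. For meets, a maximal common lower bound is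
  the greatest one, since its join with any other common lower bound is again one.\<close>

lemma finite_lattice: "finite_lattice L"
proof -
  have sup: "\<exists>s. least L s (Upper L {x, y})" if xy: "x \<in> carrier L" "y \<in> carrier L" for x y
  proof -
    have bot: "bot \<in> carrier L" "bot \<sqsubseteq> x" "bot \<sqsubseteq> y"
      using least_bot xy by (auto simp: least_def)
    then obtain m n where "path bot m x" "path bot n y"
      using path_exists xy by metis
    then show ?thesis using lub_exists bot(1) by metis
  qed
  then interpret upper_semilattice L by unfold_locales
  have "\<exists>i. is_glb L i {x, y}" if xy: "x \<in> carrier L" "y \<in> carrier L" for x y
  proof -
    have "bot \<in> Lower L {x, y}" using least_bot xy by (auto simp: least_def Lower_def)
    then obtain i where i: "i \<in> Lower L {x, y}"
      and max: "\<And>l. l \<in> Lower L {x, y} \<Longrightarrow> i \<sqsubseteq> l \<Longrightarrow> l = i"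
      using maximal_exists[of "Lower L {x, y}"] by (auto simp: Lower_def)
    have "l \<sqsubseteq> i" if l: "l \<in> Lower L {x, y}" for l
    proof -
      have car: "l \<in> carrier L" "i \<in> carrier L" using l i by (auto simp: Lower_def)
      have "i \<squnion> l \<in> Lower L {x, y}"
        using l i car xy by (auto simp: Lower_def intro: join_le)
      then have "i \<squnion> l = i" using max join_left[of i l] car by simp
      then show ?thesis using join_right[of i l] car by simp
    qed
    then have "is_glb L i {x, y}" using i Lower_closed[of L] unfolding greatest_def by blast
    then show ?thesis by blast
  qed
  then show ?thesis by unfold_locales
qed

lemma separating_unique:
  assumes xy: "(x, y) \<in> cover_arcs L" and m1: "separating L x y m1" and m2: "separating L x y m2"
  shows "m1 = m2"
proof -
  interpret finite_lattice L by (rule finite_lattice)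
  let ?i = "c (x, y)"
  have car: "x \<in> carrier L" "y \<in> carrier L" using xy by (auto simp: cover_arcs_def)
  \<comment> \<open>A path from \<open>x\<close> containing the color absorbs \<open>(x, y)\<close>
    and so ends above \<open>y\<close>; conversely, a path ending above \<open>y\<close> contains
    the color by \<open>U.color_in_path\<close>.\<close>
  have avoid: "?i \<notin># k \<longleftrightarrow> \<not> y \<sqsubseteq> m" if k: "path x k m" for m k
  proof
    assume "?i \<notin># k"
    then show "\<not> y \<sqsubseteq> m"
      using U.color_in_path[OF xy _ k] le_iff_rtrancl_cover_arcs car path_closed[OF k] by blast
  next
    assume "\<not> y \<sqsubseteq> m"
    then show "?i \<notin># k" using U.push_arc[OF k xy] path_closed car by blast
  qed
  have mc: "m1 \<in> carrier L" "m2 \<in> carrier L" using m1 m2 by (auto dest: separating_closed)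
  obtain k1 k2 where k1: "path x k1 m1" and k2: "path x k2 m2"
    using path_exists car mc m1 m2 unfolding separating_def by metis
  obtain j k where j: "path m1 k j" "set_mset k \<subseteq> set_mset k2" "least L j (Upper L {m1, m2})"
    using lub_exists[OF k1 k2 car(1)] by metis
  have i12: "?i \<notin># k1" "?i \<notin># k2" using avoid k1 k2 m1 m2 by (auto simp: separating_def)
  have jk: "path x (k1 + k) j" by (rule color_path_trans[OF k1 j(1)])
  have jc: "j \<in> carrier L" using path_closed[OF jk] car by blast
  \<comment> \<open>Stated for a general \<open>m\<close> so that it applies to \<open>m1\<close>
    and \<open>m2\<close> alike.\<close>
  have "m = j" if m: "separating L x y m" and l: "path x l m" and mj: "m \<sqsubseteq> j" for m l
  proof (rule ccontr)
    assume "m \<noteq> j"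
    have mc: "m \<in> carrier L" by (rule separating_closed[OF m])
    then obtain t where t: "(m, t) \<in> cover_arcs L" "t \<sqsubseteq> j"
      using cover_below_exists[of m j] mj jc \<open>m \<noteq> j\<close> by (auto simp: lless_eq)
    have "?i \<notin># l" using avoid l m by (auto simp: separating_def)
    \<comment> \<open>Transport of \<open>(x, y)\<close> yields an arc of the same color out of
      \<open>m\<close>. As \<open>m\<close> has only one cover, this arc is the first one on the way
      to \<open>j\<close>.\<close>
    then obtain t' where t': "(m, t') \<in> cover_arcs L" "c (m, t') = ?i"
      using U.push_arc[OF l xy] by blast
    have "t' = t"
      using meet_irreducible_unique_cover t'(1) t(1) m unfolding separating_def by blast
    obtain p where p: "path t p j" using path_exists[OF _ jc t(2)] t(1) by (auto simp: cover_arcs_def)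
    have "path x (l + add_mset ?i p) j"
      using color_path_trans[OF l color_path.step[OF t(1) p]] t'(2) \<open>t' = t\<close> by simp
    \<comment> \<open>Of these two paths from \<open>x\<close> to \<open>j\<close>, the first
      contains the color \<open>?i\<close> and the second avoids it.\<close>
    then have "l + add_mset ?i p = k1 + k" using U.color_path_unique jk by blast
    then have "?i \<in># k1 + k" by (metis union_iff union_single_eq_member)
    then show False using i12 j(2) by auto
  qed
  moreover have "m1 \<sqsubseteq> j" "m2 \<sqsubseteq> j"
    using j(3) mc by (auto simp: least_def Upper_def)
  ultimately show ?thesis using m1 m2 k1 k2 by metis
qed

lemma ULD: "ULD L"
proof -
  interpret finite_lattice L by (rule finite_lattice)
  have "carrier L \<noteq> {}" using least_bot by (auto simp: least_def)
  then show ?thesis using separating_unique_imp_ULD separating_unique by blast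
qed

end

theorem theorem1:
  shows "(\<forall>(V :: 'v set) (A :: ('v \<times> 'v) set) (c :: 'v \<times> 'v \<Rightarrow> 'c).
            finite V \<and> A \<subseteq> V \<times> V \<and> acyclic A \<and> U_coloring V A c \<longrightarrow>
            cover_arcs (closure_poset V A) = A \<and> U_poset (closure_poset V A)) \<and>
         (\<forall>P :: ('a, 'b) gorder_scheme. partial_order P \<longrightarrow>
            (finite (carrier P) \<and> ULD P \<longleftrightarrow> U_poset P \<and> (\<exists>m. least P m (carrier P))))"
proof (intro conjI allI impI)
  fix V :: "'v set" and A and c :: "'v \<times> 'v \<Rightarrow> 'c"
  assume "finite V \<and> A \<subseteq> V \<times> V \<and> acyclic A \<and> U_coloring V A c"
  then interpret U_digraph V A c by unfold_locales auto
  show "cover_arcs (closure_poset V A) = A" by (rule cover_arcs_closure)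
  show "U_poset (closure_poset V A)" by (rule U_poset_closure)
next
  fix P :: "('a, 'b) gorder_scheme"
  assume "partial_order P"
  show "finite (carrier P) \<and> ULD P \<longleftrightarrow> U_poset P \<and> (\<exists>m. least P m (carrier P))"
  proof
    assume P: "finite (carrier P) \<and> ULD P"
    then interpret lattice P by (simp add: ULD_def)
    interpret finite_lattice P using P by unfold_locales auto
    show "U_poset P \<and> (\<exists>m. least P m (carrier P))"
      using P ULD_imp_U_poset least_exists by (auto simp: ULD_def)
  next
    assume P: "U_poset P \<and> (\<exists>m. least P m (carrier P))"
    then obtain c :: "'a \<times> 'a \<Rightarrow> nat" and m where "finite (carrier P)"
      "U_coloring (carrier P) (cover_arcs P) c" "least P m (carrier P)"
      by (auto simp: U_poset_def)
    then interpret U_order P c m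
      by (intro U_order.intro finite_poset.intro finite_poset_axioms.intro U_order_axioms.intro
          \<open>partial_order P\<close>)
    show "finite (carrier P) \<and> ULD P" using ULD finite_carrier by blast
  qed
qed

end
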